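(* Let $F$ be a field and let $D_1,D_2\colon F\to F$ be two derivations of the field $F$ with incomparable kernels, i.e., $\ker D_1\not\subseteq\ker D_2$ and $\ker D_2\not\subseteq\ker D_1$ (for example, one can take $F=\mathbb{Q}(x,y)$, the field of rational functions in two independent variables, with $D_1=\partial/\partial x$, $D_2=\partial/\partial y$). Then for every integer $n\geq 2$ there exists a non-commutative, uniserial, Artinian, centrally essential ring $A$ such that $A/J(A)\cong F$ and the nilpotence index of the ideal $J(A)$ is equal to $n$.
   Context: All rings are associative with a non-zero identity element. A ring $A$ with center $C$ is centrally essential if for every non-zero $r\in A$ there exist two non-zero central elements $c,d\in C$ with $rc=d$. A module is uniserial if the set of all its submodules is linearly ordered by inclusion. A ring is called uniserial (resp. Artinian) without a side specified if it is so both as a left and as a right module over itself. $J(A)$ denotes the Jacobson radical of $A$. The nilpotence index of a nilpotent ideal $N$ is the least positive integer $n$ with $N^n=0$. *)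

theory Defs
  imports "HOL-Algebra.Algebra" "HOL-Algebra.Algebraic_Closure_Type"
begin

section \<open>Uniserial and Artinian rings\<close>

text \<open>
  The library predicate \<^term>\<open>submodule H R M\<close> does not require the scalars to be commutative, so
  it also describes the submodules of a left module over a noncommutative ring. Right modules over
  \<open>A\<close> are left modules over the opposite ring of \<open>A\<close>.
\<close>

definition opposite_ring :: "('a, 'm) ring_scheme \<Rightarrow> 'a ring" where
  "opposite_ring A =
     \<lparr>carrier = carrier A, monoid.mult = (\<lambda>x y. y \<otimes>\<^bsub>A\<^esub> x), one = \<one>\<^bsub>A\<^esub>, ring.zero = \<zero>\<^bsub>A\<^esub>, add = (\<oplus>\<^bsub>A\<^esub>)\<rparr>"

definition left_regular :: "('a, 'm) ring_scheme \<Rightarrow> ('a, 'a) module" where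
  "left_regular A =
     \<lparr>carrier = carrier A, monoid.mult = (\<otimes>\<^bsub>A\<^esub>), one = \<one>\<^bsub>A\<^esub>, ring.zero = \<zero>\<^bsub>A\<^esub>, add = (\<oplus>\<^bsub>A\<^esub>),
      module.smult = (\<otimes>\<^bsub>A\<^esub>)\<rparr>"

definition uniserial_module :: "('r, 'm) ring_scheme \<Rightarrow> ('r, 'a, 'n) module_scheme \<Rightarrow> bool" where
  "uniserial_module R M \<longleftrightarrow>
     (\<forall>H K. submodule H R M \<and> submodule K R M \<longrightarrow> H \<subseteq> K \<or> K \<subseteq> H)"

definition artinian_module :: "('r, 'm) ring_scheme \<Rightarrow> ('r, 'a, 'n) module_scheme \<Rightarrow> bool" where
  "artinian_module R M \<longleftrightarrow>
     (\<forall>H :: nat \<Rightarrow> 'a set. (\<forall>i. submodule (H i) R M \<and> H (Suc i) \<subseteq> H i)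
        \<longrightarrow> (\<exists>k. \<forall>i\<ge>k. H i = H k))"

definition uniserial_ring :: "('a, 'm) ring_scheme \<Rightarrow> bool" where
  "uniserial_ring A \<longleftrightarrow>
     uniserial_module A (left_regular A) \<and>
     uniserial_module (opposite_ring A) (left_regular (opposite_ring A))"

definition artinian_ring :: "('a, 'm) ring_scheme \<Rightarrow> bool" where
  "artinian_ring A \<longleftrightarrow>
     artinian_module A (left_regular A) \<and>
     artinian_module (opposite_ring A) (left_regular (opposite_ring A))"


section \<open>Jacobson radical and nilpotence index\<close>

definition maximal_submodule ::
    "'a set \<Rightarrow> ('r, 'm) ring_scheme \<Rightarrow> ('r, 'a, 'n) module_scheme \<Rightarrow> bool" where
  "maximal_submodule H R M \<longleftrightarrow>
     submodule H R M \<and> H \<noteq> carrier M \<and>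
     (\<forall>K. submodule K R M \<and> H \<subseteq> K \<longrightarrow> K = H \<or> K = carrier M)"

text \<open>The intersection of all maximal left ideals.\<close>

definition jacobson_radical :: "('a, 'm) ring_scheme \<Rightarrow> 'a set" where
  "jacobson_radical A = carrier A \<inter> \<Inter> {H. maximal_submodule H A (left_regular A)}"

text \<open>
  Powers of ideals are taken in the multiplicative monoid of \<^term>\<open>ideals_set A\<close>, whose product is
  \<^const>\<open>ideal_prod\<close>.
\<close>

definition has_nilpotence_index :: "('a, 'm) ring_scheme \<Rightarrow> 'a set \<Rightarrow> nat \<Rightarrow> bool" where
  "has_nilpotence_index A N n \<longleftrightarrow>
     n > 0 \<and> N [^]\<^bsub>ideals_set A\<^esub> n = {\<zero>\<^bsub>A\<^esub>} \<and>
     (\<forall>m. 0 < m \<and> m < n \<longrightarrow> N [^]\<^bsub>ideals_set A\<^esub> m \<noteq> {\<zero>\<^bsub>A\<^esub>})"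


section \<open>Centrally essential rings\<close>

definition ring_center :: "('a, 'm) ring_scheme \<Rightarrow> 'a set" where
  "ring_center A = {c \<in> carrier A. \<forall>a \<in> carrier A. c \<otimes>\<^bsub>A\<^esub> a = a \<otimes>\<^bsub>A\<^esub> c}"

definition centrally_essential :: "('a, 'm) ring_scheme \<Rightarrow> bool" where
  "centrally_essential A \<longleftrightarrow>
     (\<forall>r \<in> carrier A - {\<zero>\<^bsub>A\<^esub>}.
        \<exists>c \<in> ring_center A - {\<zero>\<^bsub>A\<^esub>}. \<exists>d \<in> ring_center A - {\<zero>\<^bsub>A\<^esub>}. r \<otimes>\<^bsub>A\<^esub> c = d)"

definition noncommutative_ring :: "('a, 'm) ring_scheme \<Rightarrow> bool" where
  "noncommutative_ring A \<longleftrightarrow> (\<exists>a \<in> carrier A. \<exists>b \<in> carrier A. a \<otimes>\<^bsub>A\<^esub> b \<noteq> b \<otimes>\<^bsub>A\<^esub> a)"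


section \<open>Derivations\<close>

definition derivation :: "('a, 'm) ring_scheme \<Rightarrow> ('a \<Rightarrow> 'a) \<Rightarrow> bool" where
  "derivation F D \<longleftrightarrow>
     D \<in> carrier F \<rightarrow> carrier F \<and>
     (\<forall>a \<in> carrier F. \<forall>b \<in> carrier F.
        D (a \<oplus>\<^bsub>F\<^esub> b) = D a \<oplus>\<^bsub>F\<^esub> D b \<and>
        D (a \<otimes>\<^bsub>F\<^esub> b) = D a \<otimes>\<^bsub>F\<^esub> b \<oplus>\<^bsub>F\<^esub> a \<otimes>\<^bsub>F\<^esub> D b)"

definition incomparable_kernels ::
    "('a, 'm) ring_scheme \<Rightarrow> ('a \<Rightarrow> 'a) \<Rightarrow> ('a \<Rightarrow> 'a) \<Rightarrow> bool" where
  "incomparable_kernels F D1 D2 \<longleftrightarrow>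
     \<not> a_kernel F F D1 \<subseteq> a_kernel F F D2 \<and> \<not> a_kernel F F D2 \<subseteq> a_kernel F F D1"


section \<open>Partial derivatives of rational functions\<close>

text \<open>
  The extension of a derivation \<open>d\<close> of a domain to its fraction field by the quotient rule. The
  value does not depend on the chosen fraction, see \<open>fract_deriv_Fract\<close> below.
\<close>

definition fract_deriv :: "('a::idom \<Rightarrow> 'a) \<Rightarrow> 'a fract \<Rightarrow> 'a fract" where
  "fract_deriv d q =
     (THE r. \<exists>a b. b \<noteq> 0 \<and> q = Fract a b \<and> r = Fract (d a * b - a * d b) (b * b))"

lemma fract_deriv_Fract:
  fixes d :: "'a::idom \<Rightarrow> 'a"
  assumes d_mult: "\<And>a b. d (a * b) = d a * b + a * d b" and "b \<noteq> 0"
  shows "fract_deriv d (Fract a b) = Fract (d a * b - a * d b) (b * b)"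
  unfolding fract_deriv_def
proof (rule the_equality)
  show "\<exists>a' b'. b' \<noteq> 0 \<and> Fract a b = Fract a' b' \<and>
          Fract (d a * b - a * d b) (b * b) = Fract (d a' * b' - a' * d b') (b' * b')"
    using \<open>b \<noteq> 0\<close> by blast
next
  fix r assume "\<exists>a' b'. b' \<noteq> 0 \<and> Fract a b = Fract a' b' \<and>
          r = Fract (d a' * b' - a' * d b') (b' * b')"
  then obtain a' b' where "b' \<noteq> 0" and eq: "Fract a b = Fract a' b'"
    and r: "r = Fract (d a' * b' - a' * d b') (b' * b')" by blast
  have cross: "a * b' = a' * b"
    using eq \<open>b \<noteq> 0\<close> \<open>b' \<noteq> 0\<close> by (simp add: eq_fract)
  then have dcross: "d a * b' + a * d b' = d a' * b + a' * d b"
    using d_mult by metis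
  have "(d a' * b' - a' * d b') * (b * b) = (d a * b - a * d b) * (b' * b')"
  proof -
    have "(d a' * b' - a' * d b') * (b * b) = b * b' * (d a' * b) - (a' * b) * (d b' * b)"
      by (simp add: algebra_simps)
    also have "\<dots> = b * b' * (d a * b' + a * d b' - a' * d b) - (a * b') * (d b' * b)"
      using cross dcross by (simp add: algebra_simps)
    also have "\<dots> = b * b' * b' * d a - (a' * b) * (b' * d b)"
      by (simp add: algebra_simps)
    also have "\<dots> = (d a * b - a * d b) * (b' * b')"
      unfolding cross[symmetric] by (simp add: algebra_simps)
    finally show ?thesis .
  qed
  then show "r = Fract (d a * b - a * d b) (b * b)"
    unfolding r using \<open>b \<noteq> 0\<close> \<open>b' \<noteq> 0\<close> by (simp add: eq_fract)
qed

text \<open>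
  The field \<open>\<rat>(x, y)\<close> is the fraction field of \<open>\<rat>[y][x]\<close>: the outer polynomial variable is \<open>x\<close>,
  the inner one is \<open>y\<close>.
\<close>

type_synonym rat_xy = "rat poly poly fract"

definition partial_x :: "rat_xy \<Rightarrow> rat_xy" where
  "partial_x = fract_deriv pderiv"

definition partial_y :: "rat_xy \<Rightarrow> rat_xy" where
  "partial_y = fract_deriv (map_poly pderiv)"

end

theory Submission
  imports Defs
begin

text \<open>
  The ring is \<open>F[x]/(x\<^sup>n)\<close> with its product deformed to \<open>f g + D\<^sub>1(f\<^sub>0) D\<^sub>2(g\<^sub>0) x\<^bsup>n-1\<^esup>\<close>. The deformation
  sees only the constant terms, so the ideal \<open>(x)\<close> is still central and multiplication still acts on
  leading terms as in \<open>F[x]/(x\<^sup>n)\<close>; hence the one-sided ideals are exactly the powers of \<open>(x)\<close>. An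
  element with non-zero constant term becomes central after multiplication by \<open>x\<^bsup>n-1\<^esup>\<close>. If \<open>D\<^sub>1 a = 0\<close>,
  \<open>D\<^sub>2 a \<noteq> 0\<close>, \<open>D\<^sub>2 b = 0\<close> and \<open>D\<^sub>1 b \<noteq> 0\<close>, then the constants \<open>a\<close> and \<open>b\<close> do not commute.
\<close>

section \<open>Derivations and Cauchy products\<close>

context ring
begin

lemma derivation_closed:
  assumes "derivation R D" "a \<in> carrier R" shows "D a \<in> carrier R"
  using assms by (auto simp: derivation_def)

lemma derivation_zero:
  assumes "derivation R D" shows "D \<zero> = \<zero>"
proof -
  have "D (\<zero> \<oplus> \<zero>) = D \<zero> \<oplus> D \<zero>" "D \<zero> \<in> carrier R"
    using assms unfolding derivation_def by blast+
  then show ?thesis by simp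
qed

lemma derivation_one:
  assumes "derivation R D" shows "D \<one> = \<zero>"
proof -
  have "D (\<one> \<otimes> \<one>) = D \<one> \<otimes> \<one> \<oplus> \<one> \<otimes> D \<one>" "D \<one> \<in> carrier R"
    using assms unfolding derivation_def by blast+
  then show ?thesis by simp
qed

lemma derivation_add:
  "\<lbrakk>derivation R D; a \<in> carrier R; b \<in> carrier R\<rbrakk> \<Longrightarrow> D (a \<oplus> b) = D a \<oplus> D b"
  by (auto simp: derivation_def)

lemma derivation_mult:
  "\<lbrakk>derivation R D; a \<in> carrier R; b \<in> carrier R\<rbrakk> \<Longrightarrow> D (a \<otimes> b) = D a \<otimes> b \<oplus> a \<otimes> D b"
  by (auto simp: derivation_def)

text \<open>The product formula of \<open>UP R\<close> without its restriction to
  \<open>up R\<close>, so degree computations need no finite-support hypotheses.\<close>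

definition conv :: "(nat \<Rightarrow> 'a) \<Rightarrow> (nat \<Rightarrow> 'a) \<Rightarrow> nat \<Rightarrow> 'a" where
  "conv f g i = (\<Oplus>k\<in>{..i}. f k \<otimes> g (i - k))"

lemma conv_closed [simp]:
  "\<lbrakk>\<And>i. f i \<in> carrier R; \<And>i. g i \<in> carrier R\<rbrakk> \<Longrightarrow> conv f g i \<in> carrier R"
  by (auto simp: conv_def)

lemma conv_UP: "f \<in> up R \<Longrightarrow> g \<in> up R \<Longrightarrow> conv f g = f \<otimes>\<^bsub>UP R\<^esub> g"
  by (auto simp: UP_def conv_def)

lemma conv_up: "f \<in> up R \<Longrightarrow> g \<in> up R \<Longrightarrow> conv f g \<in> up R"
  using up_mult_closed [of f g] by (simp add: conv_def [abs_def])

text \<open>Inherited from the polynomial ring \<open>UP R\<close>, whose product agrees with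
  \<open>conv\<close> on \<open>up R\<close>; this avoids rearranging double sums.\<close>

lemma conv_assoc:
  assumes "f \<in> up R" "g \<in> up R" "h \<in> up R"
  shows "conv (conv f g) h = conv f (conv g h)"
proof -
  have P: "carrier (UP R) = up R" by (simp add: UP_def)
  have "UP_ring R" by (simp add: UP_ring_def ring_axioms)
  then show ?thesis
    using assms UP_ring.UP_m_assoc [of R f g h] by (simp add: P conv_UP [symmetric] conv_up)
qed

text \<open>In \<open>f k \<otimes> g (i - k)\<close> an index \<open>k < a\<close> kills the first
  factor, while \<open>k > a\<close> forces \<open>i - k < b\<close> and kills the second. Only
  \<open>k = a\<close> survives, and only if \<open>i = a + b\<close>.\<close>

lemma conv_leading:
  assumes cf: "\<And>i. f i \<in> carrier R" and cg: "\<And>i. g i \<in> carrier R"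
    and f: "\<And>i. i < a \<Longrightarrow> f i = \<zero>" and g: "\<And>i. i < b \<Longrightarrow> g i = \<zero>"
    and i: "i \<le> a + b"
  shows "conv f g i = (if i = a + b then f a \<otimes> g b else \<zero>)"
proof -
  \<comment> \<open>Each summand becomes an indicator of \<open>a = k\<close>, the shape that
    \<open>finsum_singleton\<close> collapses.\<close>
  have "conv f g i = (\<Oplus>k\<in>{..i}. if a = k then (if i = a + b then f k \<otimes> g b else \<zero>) else \<zero>)"
    unfolding conv_def
  proof (rule add.finprod_cong')
    fix k assume k: "k \<in> {..i}"
    consider "k < a" | "k = a" | "k > a" by linarith
    then show "f k \<otimes> g (i - k) = (if a = k then (if i = a + b then f k \<otimes> g b else \<zero>) else \<zero>)"
    proof cases
      case 1 then show ?thesis using f cg by simp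
    next
      case 2 then show ?thesis using g [of "i - a"] cf i k by (cases "i = a + b") auto
    next
      case 3 then have "i - k < b" using i k by auto
      then show ?thesis using g cf 3 by simp
    qed
  qed (auto simp: cf cg)
  also have "\<dots> = (if i = a + b then f a \<otimes> g b else \<zero>)"
  proof (cases "a \<le> i")
    case True then show ?thesis
      by (subst finsum_singleton) (auto simp: cf cg)
  next
    case False
    then have "(\<Oplus>k\<in>{..i}. if a = k then (if i = a + b then f k \<otimes> g b else \<zero>) else \<zero>) = (\<Oplus>k\<in>{..i}. \<zero>)"
      by (intro add.finprod_cong') auto
    with False show ?thesis by simp
  qed
  finally show ?thesis .
qed

lemma conv_zero_left:
  "\<lbrakk>f 0 \<in> carrier R; g 0 \<in> carrier R\<rbrakk> \<Longrightarrow> conv f g 0 = f 0 \<otimes> g 0"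
  by (simp add: conv_def)

lemma conv_add_left:
  "\<lbrakk>\<And>i. f i \<in> carrier R; \<And>i. g i \<in> carrier R; \<And>i. h i \<in> carrier R\<rbrakk> \<Longrightarrow>
   conv (\<lambda>i. f i \<oplus> g i) h i = conv f h i \<oplus> conv g h i"
  unfolding conv_def by (subst finsum_addf [symmetric]) (auto simp: l_distr intro!: finsum_cong')

lemma conv_add_right:
  "\<lbrakk>\<And>i. f i \<in> carrier R; \<And>i. g i \<in> carrier R; \<And>i. h i \<in> carrier R\<rbrakk> \<Longrightarrow>
   conv h (\<lambda>i. f i \<oplus> g i) i = conv h f i \<oplus> conv h g i"
  unfolding conv_def by (subst finsum_addf [symmetric]) (auto simp: r_distr intro!: finsum_cong')

lemma conv_cong:
  assumes "\<And>k. k \<le> i \<Longrightarrow> f k = f' k" "\<And>k. k \<le> i \<Longrightarrow> g k = g' k"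
    "\<And>k. f' k \<in> carrier R" "\<And>k. g' k \<in> carrier R"
  shows "conv f g i = conv f' g' i"
  unfolding conv_def using assms by (intro finsum_cong') auto

end

lemma (in cring) conv_comm: "f \<in> up R \<Longrightarrow> g \<in> up R \<Longrightarrow> conv f g = conv g f"
  using UP_cring.UP_m_comm [of R f g] by (simp add: conv_UP UP_def UP_cring_def is_cring)

section \<open>The twisted truncated polynomial ring\<close>

locale twisted_truncation = field F for F :: "('a, 'm) ring_scheme" (structure) +
  fixes D1 D2 :: "'a \<Rightarrow> 'a" and n :: nat
  assumes D1: "derivation F D1" and D2: "derivation F D2" and n: "n \<ge> 2"

context twisted_truncation
begin

text \<open>The correction sits in the top degree \<open>n - 1\<close>, so any factor without
  constant term annihilates it modulo degree \<open>n\<close>.\<close>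

definition twist :: "(nat \<Rightarrow> 'a) \<Rightarrow> (nat \<Rightarrow> 'a) \<Rightarrow> nat \<Rightarrow> 'a" where
  "twist f g i = (if i = n - 1 then D1 (f 0) \<otimes> D2 (g 0) else \<zero>)"

definition single :: "'a \<Rightarrow> nat \<Rightarrow> nat \<Rightarrow> 'a" where
  "single c j = (\<lambda>i. if i = j then c else \<zero>)"

text \<open>A class modulo x^n is represented by its polynomial of degree below \<open>n\<close>,
  padded with zeros; the test \<open>i < n\<close> performs the reduction.\<close>

definition A :: "(nat \<Rightarrow> 'a) ring" where
  "A = \<lparr>carrier = {f \<in> UNIV \<rightarrow> carrier F. \<forall>i\<ge>n. f i = \<zero>},
        monoid.mult = (\<lambda>f g i. if i < n then conv f g i \<oplus> twist f g i else \<zero>),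
        one = single \<one> 0, ring.zero = (\<lambda>i. \<zero>), add = (\<lambda>f g i. f i \<oplus> g i)\<rparr>"

lemmas D_simps [simp] =
  derivation_closed [OF D1] derivation_closed [OF D2] derivation_zero [OF D1]
  derivation_zero [OF D2] derivation_one [OF D1] derivation_one [OF D2]
  derivation_add [OF D1] derivation_add [OF D2] derivation_mult [OF D1] derivation_mult [OF D2]

section \<open>Ring axioms for the twisted product\<close>

lemma A_carrierI:
  "\<lbrakk>\<And>i. f i \<in> carrier F; \<And>i. i \<ge> n \<Longrightarrow> f i = \<zero>\<rbrakk> \<Longrightarrow> f \<in> carrier A"
  by (auto simp: A_def)

lemma A_carrier_closed: "f \<in> carrier A \<Longrightarrow> f i \<in> carrier F"
  by (auto simp: A_def)

lemma A_carrier_ge: "f \<in> carrier A \<Longrightarrow> i \<ge> n \<Longrightarrow> f i = \<zero>"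
  by (auto simp: A_def)

lemma A_mult: "(f \<otimes>\<^bsub>A\<^esub> g) i = (if i < n then conv f g i \<oplus> twist f g i else \<zero>)"
  by (simp add: A_def)

lemma A_add: "f \<oplus>\<^bsub>A\<^esub> g = (\<lambda>i. f i \<oplus> g i)"
  by (simp add: A_def)

lemma A_zero: "\<zero>\<^bsub>A\<^esub> = (\<lambda>i. \<zero>)"
  by (simp add: A_def)

lemma A_one: "\<one>\<^bsub>A\<^esub> = single \<one> 0"
  by (simp add: A_def)

(* Declared only here: together with A_def this rule makes the simplifier loop. *)
declare A_carrier_closed [simp]

lemma carrier_A_up: "f \<in> carrier A \<Longrightarrow> f \<in> up F"
  by (rule mem_upI) (auto intro!: exI [of _ n] bound.intro simp: A_carrier_ge)

lemma twist_closed [simp]: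
  "\<lbrakk>f 0 \<in> carrier F; g 0 \<in> carrier F\<rbrakk> \<Longrightarrow> twist f g i \<in> carrier F"
  by (auto simp: twist_def)

lemma A_mult_closed [simp]:
  "f \<in> carrier A \<Longrightarrow> g \<in> carrier A \<Longrightarrow> f \<otimes>\<^bsub>A\<^esub> g \<in> carrier A"
  by (intro A_carrierI) (auto simp: A_mult)

lemma single_closed [simp]: "c \<in> carrier F \<Longrightarrow> j < n \<Longrightarrow> single c j \<in> carrier A"
  by (intro A_carrierI) (auto simp: single_def)

lemma A_mult_0: "f \<in> carrier A \<Longrightarrow> g \<in> carrier A \<Longrightarrow> (f \<otimes>\<^bsub>A\<^esub> g) 0 = f 0 \<otimes> g 0"
  using n by (simp add: A_mult conv_zero_left twist_def)

text \<open>A twist starts in degree \<open>n - 1\<close>, so below degree \<open>n\<close> only its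
  leading coefficient is seen, multiplied by the constant term of the other factor.\<close>

lemma conv_twist_left:
  assumes "f \<in> carrier A" "g \<in> carrier A" "h \<in> carrier A" "i < n"
  shows "conv (twist f g) h i = (if i = n - 1 then D1 (f 0) \<otimes> D2 (g 0) \<otimes> h 0 else \<zero>)"
  using assms by (subst conv_leading [where a = "n - 1" and b = 0]) (auto simp: twist_def)

lemma conv_twist_right:
  assumes "f \<in> carrier A" "g \<in> carrier A" "h \<in> carrier A" "i < n"
  shows "conv f (twist g h) i = (if i = n - 1 then f 0 \<otimes> (D1 (g 0) \<otimes> D2 (h 0)) else \<zero>)"
  using assms by (subst conv_leading [where a = 0 and b = "n - 1"]) (auto simp: twist_def)

text \<open>\<open>(a, b) \<mapsto> D1 a D2 b\<close> is a Hochschild 2-cocycle, which is what associativity of the twisted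
  product requires.\<close>

lemma A_assoc:
  assumes f: "f \<in> carrier A" and g: "g \<in> carrier A" and h: "h \<in> carrier A"
  shows "(f \<otimes>\<^bsub>A\<^esub> g) \<otimes>\<^bsub>A\<^esub> h = f \<otimes>\<^bsub>A\<^esub> (g \<otimes>\<^bsub>A\<^esub> h)"
proof
  fix i
  show "((f \<otimes>\<^bsub>A\<^esub> g) \<otimes>\<^bsub>A\<^esub> h) i = (f \<otimes>\<^bsub>A\<^esub> (g \<otimes>\<^bsub>A\<^esub> h)) i"
  proof (cases "i < n")
    case i: True
    have c: "f 0 \<in> carrier F" "g 0 \<in> carrier F" "h 0 \<in> carrier F" using f g h by auto
    \<comment> \<open>A coefficient of index \<open>i < n\<close> involves only indices below
      \<open>n\<close>, where the truncation in the inner product is invisible.\<close>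
    have "conv (f \<otimes>\<^bsub>A\<^esub> g) h i = conv (\<lambda>k. conv f g k \<oplus> twist f g k) h i"
      using i f g h by (intro conv_cong) (auto simp: A_mult)
    also have "\<dots> = conv (conv f g) h i \<oplus> conv (twist f g) h i"
      using f g h by (intro conv_add_left) auto
    finally have l: "conv (f \<otimes>\<^bsub>A\<^esub> g) h i = \<dots>" .
    have "conv f (g \<otimes>\<^bsub>A\<^esub> h) i = conv f (\<lambda>k. conv g h k \<oplus> twist g h k) i"
      using i f g h by (intro conv_cong) (auto simp: A_mult)
    also have "\<dots> = conv f (conv g h) i \<oplus> conv f (twist g h) i"
      using f g h by (intro conv_add_right) auto
    finally have r: "conv f (g \<otimes>\<^bsub>A\<^esub> h) i = \<dots>" .
    have as: "conv (conv f g) h i = conv f (conv g h) i" "conv f (conv g h) i \<in> carrier F"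
      using f g h by (auto simp: conv_assoc carrier_A_up)
    \<comment> \<open>The cocycle identity in degree \<open>n - 1\<close>: after the Leibniz rule
      both sides equal D1 f D2 g h + D1 f g D2 h + f D1 g D2 h, taken at the constant terms.\<close>
    have "conv (twist f g) h i \<oplus> twist (f \<otimes>\<^bsub>A\<^esub> g) h i = conv f (twist g h) i \<oplus> twist f (g \<otimes>\<^bsub>A\<^esub> h) i"
      using c by (simp add: conv_twist_left [OF f g h i] conv_twist_right [OF f g h i]
          twist_def A_mult_0 f g h l_distr r_distr m_assoc a_ac)
    then show ?thesis
      using i f g h as by (simp add: A_mult l r a_assoc)
  qed (simp add: A_mult)
qed

lemma conv_one_left:
  assumes "f \<in> carrier A" shows "conv (single \<one> 0) f i = f i"
proof -
  have "conv (single \<one> 0) f i = (\<Oplus>k\<in>{..i}. if 0 = k then f (i - k) else \<zero>)"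
    unfolding conv_def using assms by (intro finsum_cong') (auto simp: single_def)
  also have "\<dots> = f i" using assms by (subst finsum_singleton) auto
  finally show ?thesis .
qed

lemma ring_A: "ring A"
proof (rule ringI)
  show "abelian_group A"
  proof (rule abelian_groupI)
    show "\<exists>g\<in>carrier A. g \<oplus>\<^bsub>A\<^esub> f = \<zero>\<^bsub>A\<^esub>" if "f \<in> carrier A" for f
      using that by (intro bexI [of _ "\<lambda>i. \<ominus> f i"] A_carrierI)
        (auto simp: A_add A_zero l_neg A_carrier_ge)
  qed (auto simp: A_add A_zero A_carrier_ge a_ac intro!: A_carrierI)
  have one: "\<one>\<^bsub>A\<^esub> \<in> carrier A" using n by (simp add: A_one)
  show "Group.monoid A"
  proof (rule monoidI)
    fix f assume f: "f \<in> carrier A"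
    \<comment> \<open>The twist against the unit vanishes because derivations send
      \<open>\<one>\<close> to \<open>\<zero>\<close>.\<close>
    show "\<one>\<^bsub>A\<^esub> \<otimes>\<^bsub>A\<^esub> f = f"
      using f by (auto simp: A_mult fun_eq_iff A_carrier_ge conv_one_left twist_def A_one)
        (auto simp: single_def)
    show "f \<otimes>\<^bsub>A\<^esub> \<one>\<^bsub>A\<^esub> = f"
      using f one by (auto simp: A_mult fun_eq_iff A_carrier_ge conv_one_left twist_def A_one
          conv_comm [of f "single \<one> 0"] carrier_A_up) (auto simp: single_def)
  qed (auto simp: A_assoc one)
next
  fix f g h assume "f \<in> carrier A" "g \<in> carrier A" "h \<in> carrier A"
  then show "(f \<oplus>\<^bsub>A\<^esub> g) \<otimes>\<^bsub>A\<^esub> h = f \<otimes>\<^bsub>A\<^esub> h \<oplus>\<^bsub>A\<^esub> g \<otimes>\<^bsub>A\<^esub> h"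
    "h \<otimes>\<^bsub>A\<^esub> (f \<oplus>\<^bsub>A\<^esub> g) = h \<otimes>\<^bsub>A\<^esub> f \<oplus>\<^bsub>A\<^esub> h \<otimes>\<^bsub>A\<^esub> g"
    by (auto simp: A_mult A_add fun_eq_iff conv_add_left conv_add_right twist_def l_distr r_distr a_ac)
qed


sublocale A: ring A by (rule ring_A)

section \<open>The filtration by order of vanishing\<close>

text \<open>This is the ideal (x^k), described by vanishing coefficients.\<close>

definition ord_ideal :: "nat \<Rightarrow> (nat \<Rightarrow> 'a) set" where
  "ord_ideal k = {f \<in> carrier A. \<forall>i<k. f i = \<zero>}"

lemma ord_ideal_subset: "f \<in> ord_ideal k \<Longrightarrow> f \<in> carrier A"
  by (simp add: ord_ideal_def)

lemma ord_ideal_0: "ord_ideal 0 = carrier A"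
  by (simp add: ord_ideal_def)

lemma ord_ideal_ge: "k \<ge> n \<Longrightarrow> ord_ideal k = {\<zero>\<^bsub>A\<^esub>}"
  using A.zero_closed by (auto simp: ord_ideal_def A_zero fun_eq_iff) (metis A_carrier_ge not_le order_trans)

lemma ord_ideal_antimono: "k \<le> l \<Longrightarrow> ord_ideal l \<subseteq> ord_ideal k"
  by (auto simp: ord_ideal_def)

lemma single_in_ord_ideal: "c \<in> carrier F \<Longrightarrow> k < n \<Longrightarrow> single c k \<in> ord_ideal k"
  by (simp add: ord_ideal_def) (simp add: single_def)

lemma A_uminus:
  assumes "f \<in> carrier A" shows "\<ominus>\<^bsub>A\<^esub> f = (\<lambda>i. \<ominus> f i)"
proof (rule A.minus_equality)
  show "(\<lambda>i. \<ominus> f i) \<oplus>\<^bsub>A\<^esub> f = \<zero>\<^bsub>A\<^esub>" "(\<lambda>i. \<ominus> f i) \<in> carrier A"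
    using assms by (auto simp: A_add A_zero l_neg A_carrier_ge intro!: A_carrierI)
qed fact

lemma A_minus: "f \<in> carrier A \<Longrightarrow> g \<in> carrier A \<Longrightarrow> f \<ominus>\<^bsub>A\<^esub> g = (\<lambda>i. f i \<ominus> g i)"
  by (simp add: a_minus_def A_uminus A_add)

text \<open>The Cauchy part is \<open>conv_leading\<close>; the twist does not disturb it, since in
  the degrees considered one of the two constant terms is zero whenever \<open>n - 1\<close> is
  reached.\<close>

lemma mult_leading:
  assumes f: "f \<in> ord_ideal a" and g: "g \<in> ord_ideal b"
  shows "f \<otimes>\<^bsub>A\<^esub> g \<in> ord_ideal (a + b)" and "a + b < n \<Longrightarrow> (f \<otimes>\<^bsub>A\<^esub> g) (a + b) = f a \<otimes> g b"
proof -
  have c: "f \<in> carrier A" "g \<in> carrier A" using f g by (auto simp: ord_ideal_subset)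
  have z: "\<And>i. i < a \<Longrightarrow> f i = \<zero>" "\<And>i. i < b \<Longrightarrow> g i = \<zero>"
    using f g by (auto simp: ord_ideal_def)
  have conv: "conv f g i = (if i = a + b then f a \<otimes> g b else \<zero>)" if "i \<le> a + b" for i
    using that c z by (intro conv_leading) auto
  have tw: "twist f g i = \<zero>" if "i \<le> a + b" for i
  proof (cases "i = n - 1")
    case True
    \<comment> \<open>Here \<open>n \<ge> 2\<close> matters: degree \<open>n - 1\<close> is
      positive, so \<open>a + b\<close> is positive as well.\<close>
    then have "a > 0 \<or> b > 0" using that n by auto
    then have "f 0 = \<zero> \<or> g 0 = \<zero>" using z by blast
    then show ?thesis using c by (auto simp: twist_def)
  qed (simp add: twist_def)
  show "f \<otimes>\<^bsub>A\<^esub> g \<in> ord_ideal (a + b)"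
    using c by (auto simp: ord_ideal_def A_mult conv tw)
  show "(f \<otimes>\<^bsub>A\<^esub> g) (a + b) = f a \<otimes> g b" if "a + b < n"
    using that c by (simp add: A_mult conv tw)
qed

lemma ord_ideal_ideal: "ideal (ord_ideal k) A"
proof (rule idealI [OF ring_A])
  show "subgroup (ord_ideal k) (add_monoid A)"
  proof (rule A.add.subgroupI)
    show "ord_ideal k \<noteq> {}" using A.zero_closed by (auto simp: ord_ideal_def A_zero)
    show "\<ominus>\<^bsub>A\<^esub> f \<in> ord_ideal k" if "f \<in> ord_ideal k" for f
      using that A.a_inv_closed [of f] by (simp add: ord_ideal_def A_uminus)
    show "f \<oplus>\<^bsub>A\<^esub> g \<in> ord_ideal k" if "f \<in> ord_ideal k" "g \<in> ord_ideal k" for f g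
      using that A.a_closed [of f g] by (simp add: ord_ideal_def A_add)
  qed (auto simp: ord_ideal_subset)
next
  fix f g assume "f \<in> ord_ideal k" "g \<in> carrier A"
  then show "g \<otimes>\<^bsub>A\<^esub> f \<in> ord_ideal k" "f \<otimes>\<^bsub>A\<^esub> g \<in> ord_ideal k"
    using mult_leading(1) [of g 0 f k] mult_leading(1) [of f k g 0] by (auto simp: ord_ideal_0)
qed

section \<open>Classification of the one-sided ideals\<close>

text \<open>The disjunction lets left and right ideals share all later arguments.\<close>

definition one_sided :: "(nat \<Rightarrow> 'a) set \<Rightarrow> bool" where
  "one_sided H \<longleftrightarrow> subgroup H (add_monoid A) \<and>
     ((\<forall>a\<in>carrier A. \<forall>h\<in>H. a \<otimes>\<^bsub>A\<^esub> h \<in> H) \<or> (\<forall>a\<in>carrier A. \<forall>h\<in>H. h \<otimes>\<^bsub>A\<^esub> a \<in> H))"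

text \<open>Subtracting from \<open>g\<close> a multiple of \<open>f\<close> with the same leading
  term raises the order of \<open>g\<close>; after finitely many rounds the order reaches
  \<open>n\<close> and the remainder is zero.\<close>

lemma one_sided_superset:
  assumes H: "one_sided H" and fH: "f \<in> H" and fI: "f \<in> ord_ideal k" and fk: "f k \<noteq> \<zero>"
  shows "ord_ideal k \<subseteq> H"
proof -
  interpret H: subgroup H "add_monoid A" using H by (simp add: one_sided_def)
  have add: "x \<oplus>\<^bsub>A\<^esub> y \<in> H" if "x \<in> H" "y \<in> H" for x y using H.m_closed that by simp
  have "g \<in> H" if "k \<le> m" "g \<in> ord_ideal m" for g m
    using that
  proof (induction "n - m" arbitrary: m g)
    case 0
    then show ?case using H.one_closed by (auto simp: ord_ideal_ge)
  next
    case (Suc d)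
    then have m: "m < n" by simp
    have gc: "g \<in> carrier A" using Suc.prems by (simp add: ord_ideal_subset)
    have fc: "f \<in> carrier A" using fI by (simp add: ord_ideal_subset)
    \<comment> \<open>Chosen so that the product of \<open>f\<close> with c x^(m-k), on either side,
      has coefficient \<open>g m\<close> in degree \<open>m\<close>.\<close>
    define c where "c = g m \<otimes> inv (f k)"
    have U: "f k \<in> Units F" using fc fk by (simp add: field_Units)
    have c: "c \<in> carrier F" using U gc by (simp add: c_def)
    have cf: "c \<otimes> f k = g m" using U gc fc by (simp add: c_def m_assoc)
    have x: "single c (m - k) \<in> ord_ideal (m - k)" using c m by (intro single_in_ord_ideal) auto
    have "\<exists>h. h \<in> H \<and> h \<in> ord_ideal m \<and> h m = g m"
    proof -
      consider "single c (m - k) \<otimes>\<^bsub>A\<^esub> f \<in> H" | "f \<otimes>\<^bsub>A\<^esub> single c (m - k) \<in> H"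
        using H fH ord_ideal_subset [OF x] by (auto simp: one_sided_def)
      then show ?thesis
      proof cases
        case 1
        then show ?thesis
          using mult_leading [OF x fI] Suc.prems(1) m cf
          by (intro exI [of _ "single c (m - k) \<otimes>\<^bsub>A\<^esub> f"]) (simp add: single_def)
      next
        case 2
        then show ?thesis
          \<comment> \<open>On this side the leading coefficient is \<open>f k \<otimes> c\<close>;
            commutativity of the field turns it into \<open>g m\<close>.\<close>
          using mult_leading [OF fI x] Suc.prems(1) m cf c fc
          by (intro exI [of _ "f \<otimes>\<^bsub>A\<^esub> single c (m - k)"]) (simp add: single_def m_comm)
      qed
    qed
    then obtain h where h: "h \<in> H" "h \<in> ord_ideal m" "h m = g m" by blast
    have hc: "h \<in> carrier A" using h by (simp add: ord_ideal_subset)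
    have "g \<ominus>\<^bsub>A\<^esub> h \<in> ord_ideal (Suc m)"
      using Suc.prems(2) h gc hc A.minus_closed [OF gc hc] by (auto simp: ord_ideal_def A_minus less_Suc_eq)
    then have "g \<ominus>\<^bsub>A\<^esub> h \<in> H"
      using Suc.hyps(1) [of "Suc m"] Suc.hyps(2) Suc.prems(1) by simp
    then have "(g \<ominus>\<^bsub>A\<^esub> h) \<oplus>\<^bsub>A\<^esub> h \<in> H" using h add by blast
    then show ?case using gc hc by (simp add: a_minus_def A.a_assoc A.l_neg)
  qed
  then show ?thesis by blast
qed

text \<open>For non-zero \<open>H\<close>, the least degree \<open>k\<close> in which some element
  of \<open>H\<close> has a non-zero coefficient gives one inclusion by minimality and the other by
  \<open>one_sided_superset\<close>.\<close>

lemma one_sided_eq_ord_ideal: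
  assumes H: "one_sided H"
  shows "\<exists>k\<le>n. H = ord_ideal k"
proof -
  interpret H: subgroup H "add_monoid A" using H by (simp add: one_sided_def)
  have HA: "H \<subseteq> carrier A" using H.subset by simp
  show ?thesis
  proof (cases "H = {\<zero>\<^bsub>A\<^esub>}")
    case True
    then show ?thesis using ord_ideal_ge by blast
  next
    case False
    let ?P = "\<lambda>k. \<exists>f\<in>H. f k \<noteq> \<zero>"
    define k where "k = (LEAST k. ?P k)"
    have "\<exists>k. ?P k" using False H.one_closed by (auto simp: A_zero fun_eq_iff)
    then have "?P k" unfolding k_def by (rule LeastI_ex)
    then obtain f where f: "f \<in> H" "f k \<noteq> \<zero>" by blast
    have low: "g i = \<zero>" if "g \<in> H" "i < k" for g i
      using that not_less_Least unfolding k_def by blast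
    have "H \<subseteq> ord_ideal k" using HA low by (auto simp: ord_ideal_def)
    moreover have "ord_ideal k \<subseteq> H"
      using one_sided_superset [OF H f(1) _ f(2)] \<open>H \<subseteq> ord_ideal k\<close> f(1) by blast
    moreover have "k < n" using f HA A_carrier_ge [of f k] by (meson not_le subsetD)
    ultimately show ?thesis by (intro exI [of _ k]) auto
  qed
qed

section \<open>Submodules, uniseriality and the chain condition\<close>

lemma left_submodule:
  "submodule H A (left_regular A) \<longleftrightarrow>
     subgroup H (add_monoid A) \<and> (\<forall>a\<in>carrier A. \<forall>h\<in>H. a \<otimes>\<^bsub>A\<^esub> h \<in> H)"
  by (auto simp: submodule_def submodule_axioms_def left_regular_def subgroup_def m_inv_def)

text \<open>Left scalar multiplication over the opposite ring is right multiplication in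
  \<open>A\<close>.\<close>

lemma right_submodule:
  "submodule H (opposite_ring A) (left_regular (opposite_ring A)) \<longleftrightarrow>
     subgroup H (add_monoid A) \<and> (\<forall>a\<in>carrier A. \<forall>h\<in>H. h \<otimes>\<^bsub>A\<^esub> a \<in> H)"
  by (auto simp: submodule_def submodule_axioms_def left_regular_def opposite_ring_def
      subgroup_def m_inv_def)

lemma submodule_one_sided:
  "submodule H A (left_regular A) \<Longrightarrow> one_sided H"
  "submodule H (opposite_ring A) (left_regular (opposite_ring A)) \<Longrightarrow> one_sided H"
  by (auto simp: left_submodule right_submodule one_sided_def)

lemma left_submodule_eq_ord_ideal: "submodule H A (left_regular A) \<longleftrightarrow> (\<exists>k\<le>n. H = ord_ideal k)"
proof
  assume "\<exists>k\<le>n. H = ord_ideal k"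
  then obtain k where k: "H = ord_ideal k" by blast
  interpret ideal "ord_ideal k" A by (rule ord_ideal_ideal)
  show "submodule H A (left_regular A)"
    unfolding left_submodule k using a_subgroup I_l_closed by blast
qed (simp add: one_sided_eq_ord_ideal submodule_one_sided)

lemma one_sided_linear: "one_sided H \<Longrightarrow> one_sided K \<Longrightarrow> H \<subseteq> K \<or> K \<subseteq> H"
  using one_sided_eq_ord_ideal [of H] one_sided_eq_ord_ideal [of K] ord_ideal_antimono nat_le_linear by blast

text \<open>At most \<open>n + 1\<close> ideals are available, so the chain has a minimal term, and
  a decreasing chain is constant from there on.\<close>

lemma one_sided_chain_stable:
  assumes H: "\<And>i. one_sided (H i)" and dec: "\<And>i. H (Suc i) \<subseteq> H (i::nat)"
  shows "\<exists>k. \<forall>i\<ge>k. H i = H k"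
proof -
  have "range H \<subseteq> ord_ideal ` {..n}" using one_sided_eq_ord_ideal [OF H] by fastforce
  then have fin: "finite (range H)" by (rule finite_subset) simp
  have anti: "H j \<subseteq> H i" if "i \<le> j" for i j
    using dec that by (rule lift_Suc_antimono_le)
  have "\<exists>M\<in>range H. \<forall>S\<in>range H. S \<subseteq> M \<longrightarrow> M = S"
    using fin by (rule finite_has_minimal) simp
  then obtain k where "\<And>i. H i \<subseteq> H k \<Longrightarrow> H k = H i" by auto
  then have "\<forall>i\<ge>k. H i = H k" using anti by metis
  then show ?thesis ..
qed

lemma uniserial_A: "uniserial_ring A"
  unfolding uniserial_ring_def uniserial_module_def
  using one_sided_linear submodule_one_sided by blast

lemma artinian_A: "artinian_ring A"
  unfolding artinian_ring_def artinian_module_def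
  using one_sided_chain_stable submodule_one_sided by blast

section \<open>Jacobson radical, residue field and nilpotence index\<close>

lemma ord_ideal_proper: "k \<ge> 1 \<Longrightarrow> ord_ideal k \<noteq> carrier A"
proof
  assume "k \<ge> 1" "ord_ideal k = carrier A"
  moreover have "single \<one> 0 \<in> carrier A" using n by simp
  ultimately have "single \<one> 0 \<in> ord_ideal k" by blast
  then have "single \<one> 0 0 = \<zero>" using \<open>k \<ge> 1\<close> by (auto simp: ord_ideal_def)
  then show False by (simp add: single_def)
qed

text \<open>All left ideals lie in the chain of the \<open>ord_ideal k\<close>, whose largest proper
  member is \<open>ord_ideal 1\<close>; so \<open>A\<close> is local.\<close>

lemma maximal_submodule_A: "maximal_submodule H A (left_regular A) \<longleftrightarrow> H = ord_ideal 1"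
proof
  have c: "carrier (left_regular A) = carrier A" by (simp add: left_regular_def)
  have I1: "submodule (ord_ideal 1) A (left_regular A)"
    using n unfolding left_submodule_eq_ord_ideal by (intro exI [of _ 1]) auto
  have above: "K = ord_ideal 1 \<or> K = carrier A"
    if K: "submodule K A (left_regular A)" "ord_ideal 1 \<subseteq> K" for K
  proof -
    obtain k where k: "K = ord_ideal k" using K(1) unfolding left_submodule_eq_ord_ideal by blast
    show ?thesis
    proof (cases "k = 0")
      case False
      then have "K \<subseteq> ord_ideal 1" unfolding k by (intro ord_ideal_antimono) simp
      then show ?thesis using K(2) by blast
    qed (simp add: k ord_ideal_0)
  qed
  show "maximal_submodule H A (left_regular A)" if "H = ord_ideal 1"
    unfolding maximal_submodule_def that c using I1 ord_ideal_proper [of 1] above by blast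
  show "H = ord_ideal 1" if H: "maximal_submodule H A (left_regular A)"
  proof -
    obtain k where k: "H = ord_ideal k"
      using H unfolding maximal_submodule_def left_submodule_eq_ord_ideal by blast
    moreover have "k \<noteq> 0"
      using H unfolding maximal_submodule_def c k by (auto simp: ord_ideal_0)
    ultimately have "H \<subseteq> ord_ideal 1" by (simp add: ord_ideal_antimono)
    then show ?thesis
      using H I1 ord_ideal_proper [OF order_refl] unfolding maximal_submodule_def c by blast
  qed
qed

lemma jacobson_radical_A: "jacobson_radical A = ord_ideal 1"
proof -
  have "{H. maximal_submodule H A (left_regular A)} = {ord_ideal 1}"
    unfolding maximal_submodule_A by simp
  moreover have "ord_ideal 1 \<subseteq> carrier A" using ord_ideal_subset by blast
  ultimately show ?thesis unfolding jacobson_radical_def by (simp add: Int_absorb1)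
qed

text \<open>The constant term is a surjective ring homomorphism with kernel
  \<open>ord_ideal 1\<close>; the twist, in degree \<open>n - 1 \<ge> 1\<close>, does not reach
  it.\<close>

lemma quotient_iso: "A Quot (ord_ideal 1) \<simeq> F"
proof -
  have h: "ring_hom_ring A F (\<lambda>f. f 0)"
  proof (rule ring_hom_ringI [OF ring_A ring_axioms])
    show "\<one>\<^bsub>A\<^esub> 0 = \<one>" by (simp add: A_one single_def)
    fix f g assume "f \<in> carrier A" "g \<in> carrier A"
    then show "f 0 \<in> carrier F" "(f \<otimes>\<^bsub>A\<^esub> g) 0 = f 0 \<otimes> g 0" "(f \<oplus>\<^bsub>A\<^esub> g) 0 = f 0 \<oplus> g 0"
      by (auto simp only: A_carrier_closed A_mult_0 A_add)
  qed
  have "a_kernel A F (\<lambda>f. f 0) = ord_ideal 1"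
    by (auto simp: a_kernel_def' ord_ideal_def)
  moreover have "(\<lambda>f. f 0) ` carrier A = carrier F"
  proof
    show "carrier F \<subseteq> (\<lambda>f. f 0) ` carrier A"
    proof
      fix c assume "c \<in> carrier F"
      then have "single c 0 \<in> carrier A" "c = single c 0 0" using n by simp (simp add: single_def)
      then show "c \<in> (\<lambda>f. f 0) ` carrier A" by blast
    qed
  qed (use A_carrier_closed in blast)
  ultimately show ?thesis using ring_hom_ring.FactRing_iso [OF h] by simp
qed

text \<open>Orders add under multiplication, which gives one inclusion. For the other, x^k times x
  has order exactly \<open>k + 1\<close> when that is below \<open>n\<close>, and
  \<open>one_sided_superset\<close> applies.\<close>

lemma ideal_prod_ord_ideal: "ideal_prod A (ord_ideal k) (ord_ideal 1) = ord_ideal (Suc k)"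
proof
  interpret K: ideal "ideal_prod A (ord_ideal k) (ord_ideal 1)" A
    by (rule A.ideal_prod_is_ideal) (rule ord_ideal_ideal)+
  interpret J: ideal "ord_ideal (Suc k)" A by (rule ord_ideal_ideal)
  show "ideal_prod A (ord_ideal k) (ord_ideal 1) \<subseteq> ord_ideal (Suc k)"
  proof
    fix f assume "f \<in> ideal_prod A (ord_ideal k) (ord_ideal 1)"
    then show "f \<in> ord_ideal (Suc k)"
      by induction (use mult_leading(1) [of _ k _ 1] J.a_closed in auto)
  qed
  show "ord_ideal (Suc k) \<subseteq> ideal_prod A (ord_ideal k) (ord_ideal 1)"
  proof (cases "Suc k < n")
    case True
    have m: "single \<one> k \<in> ord_ideal k" "single \<one> 1 \<in> ord_ideal 1"
      using True by (auto intro: single_in_ord_ideal)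
    have one: "one_sided (ideal_prod A (ord_ideal k) (ord_ideal 1))"
      using K.a_subgroup K.I_l_closed by (auto simp: one_sided_def)
    show ?thesis
    proof (rule one_sided_superset [OF one])
      show "single \<one> k \<otimes>\<^bsub>A\<^esub> single \<one> 1 \<in> ideal_prod A (ord_ideal k) (ord_ideal 1)"
        using m by (rule ideal_prod.prod)
      show "single \<one> k \<otimes>\<^bsub>A\<^esub> single \<one> 1 \<in> ord_ideal (Suc k)"
        using mult_leading(1) [OF m] by simp
      show "(single \<one> k \<otimes>\<^bsub>A\<^esub> single \<one> 1) (Suc k) \<noteq> \<zero>"
        using mult_leading(2) [OF m] True by (simp add: single_def)
    qed
  next
    case False
    then show ?thesis using K.zero_closed by (simp add: ord_ideal_ge)
  qed
qed

lemma pow_ord_ideal: "ord_ideal 1 [^]\<^bsub>ideals_set A\<^esub> (m::nat) = ord_ideal m"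
proof (induction m)
  \<comment> \<open>The empty power is the unit of the monoid of ideals, the whole ring.\<close>
  case 0 then show ?case by (simp add: nat_pow_def ideals_set_def ord_ideal_0)
next
  case (Suc m)
  have "ord_ideal 1 [^]\<^bsub>ideals_set A\<^esub> Suc m = ord_ideal 1 [^]\<^bsub>ideals_set A\<^esub> m \<otimes>\<^bsub>ideals_set A\<^esub> ord_ideal 1"
    by (simp add: nat_pow_def)
  then show ?case using Suc by (simp add: ideals_set_def ideal_prod_ord_ideal [simplified])
qed

text \<open>For \<open>m < n\<close> the monomial x^m is a non-zero element of the
  \<open>m\<close>-th power.\<close>

lemma nilpotence_A: "has_nilpotence_index A (ord_ideal 1) n"
proof -
  have "ord_ideal m \<noteq> {\<zero>\<^bsub>A\<^esub>}" if "m < n" for m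
  proof
    assume "ord_ideal m = {\<zero>\<^bsub>A\<^esub>}"
    then have "single \<one> m m = \<zero>" using single_in_ord_ideal [of \<one> m] that by (auto simp: A_zero)
    then show False by (simp add: single_def)
  qed
  then show ?thesis using n by (auto simp: has_nilpotence_index_def pow_ord_ideal [simplified] ord_ideal_ge)
qed

section \<open>Centre and non-commutativity\<close>

text \<open>A zero constant term makes both twists vanish, and the Cauchy product over a field is
  commutative.\<close>

lemma ord_ideal_1_central: "f \<in> ord_ideal 1 \<Longrightarrow> f \<in> ring_center A"
  by (auto simp: ring_center_def ord_ideal_def A_mult fun_eq_iff twist_def conv_comm [of f] carrier_A_up)

lemma centrally_essential_A: "centrally_essential A"
  unfolding centrally_essential_def
proof
  fix r assume r: "r \<in> carrier A - {\<zero>\<^bsub>A\<^esub>}"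
  show "\<exists>c\<in>ring_center A - {\<zero>\<^bsub>A\<^esub>}. \<exists>d\<in>ring_center A - {\<zero>\<^bsub>A\<^esub>}. r \<otimes>\<^bsub>A\<^esub> c = d"
  proof (cases "r 0 = \<zero>")
    case True
    \<comment> \<open>Such an \<open>r\<close> is itself central, so \<open>c\<close> can be the
      unit.\<close>
    then have "r \<in> ring_center A" using r by (intro ord_ideal_1_central) (auto simp: ord_ideal_def)
    moreover have "\<one>\<^bsub>A\<^esub> \<in> ring_center A" by (auto simp: ring_center_def)
    moreover have "\<one>\<^bsub>A\<^esub> \<noteq> \<zero>\<^bsub>A\<^esub>" using r A.one_zeroD by auto
    ultimately show ?thesis using r by (intro bexI [of _ "\<one>\<^bsub>A\<^esub>"] bexI [of _ r]) auto
  next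
    case False
    \<comment> \<open>Multiplying by x^(n-1) leaves only \<open>r 0\<close> in degree
      \<open>n - 1\<close>: non-zero, and central because \<open>n - 1 \<ge> 1\<close>.\<close>
    define c where "c = single \<one> (n - 1)"
    have c: "c \<in> ord_ideal (n - 1)" using n by (auto simp: c_def intro: single_in_ord_ideal)
    have rI: "r \<in> ord_ideal 0" using r by (simp add: ord_ideal_0)
    have rc: "r \<otimes>\<^bsub>A\<^esub> c \<in> ord_ideal (n - 1)" "(r \<otimes>\<^bsub>A\<^esub> c) (n - 1) = r 0"
      using mult_leading [OF rI c] n r by (auto simp: c_def single_def)
    have "c \<noteq> \<zero>\<^bsub>A\<^esub>" by (auto simp: c_def single_def A_zero fun_eq_iff)
    moreover have "r \<otimes>\<^bsub>A\<^esub> c \<noteq> \<zero>\<^bsub>A\<^esub>" using rc False by (auto simp: A_zero)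
    moreover have "ord_ideal (n - 1) \<subseteq> ring_center A"
    proof -
      have "ord_ideal (n - 1) \<subseteq> ord_ideal 1" using n by (intro ord_ideal_antimono) simp
      then show ?thesis using ord_ideal_1_central by blast
    qed
    ultimately show ?thesis using c rc by blast
  qed
qed

lemma noncommutative_A:
  assumes "incomparable_kernels F D1 D2" shows "noncommutative_ring A"
proof -
  obtain a b where a: "a \<in> carrier F" "D1 a = \<zero>" "D2 a \<noteq> \<zero>"
    and b: "b \<in> carrier F" "D2 b = \<zero>" "D1 b \<noteq> \<zero>"
    using assms by (auto simp: incomparable_kernels_def a_kernel_def')
  define f where "f = single a 0"
  define g where "g = single b 0"
  have c: "f \<in> carrier A" "g \<in> carrier A" "f 0 = a" "g 0 = b"
    using a b n by (auto simp: f_def g_def) (auto simp: single_def)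
  have "f \<otimes>\<^bsub>A\<^esub> g \<noteq> g \<otimes>\<^bsub>A\<^esub> f"
  proof
    assume "f \<otimes>\<^bsub>A\<^esub> g = g \<otimes>\<^bsub>A\<^esub> f"
    then have "(f \<otimes>\<^bsub>A\<^esub> g) (n - 1) = (g \<otimes>\<^bsub>A\<^esub> f) (n - 1)" by simp
    \<comment> \<open>In degree \<open>n - 1\<close> the Cauchy parts agree and the twist of
      \<open>f\<close> and \<open>g\<close> is D1 a D2 b = 0, so the twist of \<open>g\<close> and
      \<open>f\<close> would have to vanish too.\<close>
    then have "D1 b \<otimes> D2 a = \<zero>"
      using c n a b conv_comm [of f g]
      by (simp add: A_mult twist_def carrier_A_up)
    then show False using a b integral_iff [of "D1 b" "D2 a"] by simp
  qed
  then show ?thesis using c by (auto simp: noncommutative_ring_def)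
qed

lemma properties_A:
  assumes "incomparable_kernels F D1 D2"
  shows "ring A \<and> \<one>\<^bsub>A\<^esub> \<noteq> \<zero>\<^bsub>A\<^esub> \<and> noncommutative_ring A \<and> uniserial_ring A \<and>
         artinian_ring A \<and> centrally_essential A \<and>
         A Quot (jacobson_radical A) \<simeq> F \<and> has_nilpotence_index A (jacobson_radical A) n"
proof -
  have "\<one>\<^bsub>A\<^esub> 0 \<noteq> \<zero>\<^bsub>A\<^esub> 0" by (simp add: A_one A_zero single_def)
  then have "\<one>\<^bsub>A\<^esub> \<noteq> \<zero>\<^bsub>A\<^esub>" by metis
  then show ?thesis
    unfolding jacobson_radical_A
    using ring_A noncommutative_A [OF assms] uniserial_A artinian_A centrally_essential_A
      quotient_iso nilpotence_A by blast
qed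

end

section \<open>The field \<open>\<rat>(x, y)\<close>\<close>

text \<open>On chosen representatives the quotient rule reduces both laws to identities in the
  domain after clearing denominators.\<close>

lemma derivation_fract_deriv:
  fixes d :: "'a::idom \<Rightarrow> 'a"
  assumes add: "\<And>a b. d (a + b) = d a + d b" and mult: "\<And>a b. d (a * b) = d a * b + a * d b"
  shows "derivation (ring_of_type_algebra :: 'a fract ring) (fract_deriv d)"
proof -
  have "fract_deriv d (p + q) = fract_deriv d p + fract_deriv d q \<and>
        fract_deriv d (p * q) = fract_deriv d p * q + p * fract_deriv d q" for p q
  proof -
    obtain a b where p: "p = Fract a b" "b \<noteq> 0" by (cases p)
    obtain c e where q: "q = Fract c e" "e \<noteq> 0" by (cases q)
    show ?thesis
      using p q by (simp add: fract_deriv_Fract [OF mult] eq_fract add mult) (simp add: algebra_simps)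
  qed
  then show ?thesis by (simp add: derivation_def ring_of_type_algebra_def)
qed

lemma fract_deriv_of_ring:
  fixes d :: "'a::idom \<Rightarrow> 'a"
  assumes mult: "\<And>a b. d (a * b) = d a * b + a * d b"
  shows "fract_deriv d (Fract a 1) = Fract (d a) 1"
proof -
  have "d 1 = d 1 + d 1" using mult [of 1 1] by simp
  \<comment> \<open>With this the quotient rule over denominator 1 reduces to
    \<open>d\<close>.\<close>
  then have "d 1 = 0" by (metis add_cancel_right_right)
  then show ?thesis by (simp add: fract_deriv_Fract [OF mult])
qed

lemma pderiv_sum: "pderiv (sum f S) = (\<Sum>x\<in>S. pderiv (f x))"
  using higher_pderiv_sum [of 1 f S] by simp

lemma map_poly_pderiv_add:
  fixes p q :: "'a::idom poly poly"
  shows "map_poly pderiv (p + q) = map_poly pderiv p + map_poly pderiv q"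
  by (simp add: poly_eq_iff coeff_map_poly pderiv_add)

lemma pderiv_Leibniz: "pderiv (p * q) = pderiv p * q + p * pderiv q" for p q :: "'a::idom poly"
  by (simp add: pderiv_mult algebra_simps)

text \<open>Coefficientwise differentiation obeys the Leibniz rule because each summand of a product
  coefficient does.\<close>

lemma map_poly_pderiv_mult:
  fixes p q :: "'a::idom poly poly"
  shows "map_poly pderiv (p * q) = map_poly pderiv p * q + p * map_poly pderiv q"
  by (rule poly_eqI)
    (simp add: coeff_map_poly coeff_mult pderiv_sum pderiv_Leibniz sum.distrib)

lemma a_kernel_type_algebra:
  fixes D :: "'a::field \<Rightarrow> 'a"
  shows "a_kernel ring_of_type_algebra ring_of_type_algebra D = {x. D x = 0}"
  by (simp add: a_kernel_def' ring_of_type_algebra_def)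

lemma incomparable_kernels_partials:
  "incomparable_kernels (ring_of_type_algebra :: rat_xy ring) partial_x partial_y"
proof -
  let ?x = "Fract [:0, 1:] 1 :: rat_xy" and ?y = "Fract [:[:0, 1:]:] 1 :: rat_xy"
  \<comment> \<open>\<open>?y\<close> refutes the inclusion of the kernel of
    \<open>partial_x\<close> in that of \<open>partial_y\<close>, and \<open>?x\<close> refutes the
    reverse one.\<close>
  have "partial_x ?x \<noteq> 0" "partial_x ?y = 0" "partial_y ?x = 0" "partial_y ?y \<noteq> 0"
    by (simp_all add: partial_x_def partial_y_def fract_deriv_of_ring pderiv_Leibniz
        map_poly_pderiv_mult pderiv_pCons map_poly_pCons Zero_fract_def eq_fract)
  then show ?thesis
    unfolding incomparable_kernels_def a_kernel_type_algebra by blast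
qed

theorem proposition2p9:
  shows "(\<forall>(F :: ('a, 'm) ring_scheme) D1 D2.
            field F \<and> derivation F D1 \<and> derivation F D2 \<and> incomparable_kernels F D1 D2 \<longrightarrow>
            (\<forall>n::nat. n \<ge> 2 \<longrightarrow>
               (\<exists>A :: (nat \<Rightarrow> 'a) ring.
                  ring A \<and> \<one>\<^bsub>A\<^esub> \<noteq> \<zero>\<^bsub>A\<^esub> \<and> noncommutative_ring A \<and> uniserial_ring A \<and>
                  artinian_ring A \<and> centrally_essential A \<and>
                  A Quot (jacobson_radical A) \<simeq> F \<and>
                  has_nilpotence_index A (jacobson_radical A) n)))
       \<and> (let F = (ring_of_type_algebra :: rat_xy ring) in
            field F \<and> derivation F partial_x \<and> derivation F partial_y \<and>
            incomparable_kernels F partial_x partial_y)"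
proof -
  have "\<exists>A :: (nat \<Rightarrow> 'a) ring.
          ring A \<and> \<one>\<^bsub>A\<^esub> \<noteq> \<zero>\<^bsub>A\<^esub> \<and> noncommutative_ring A \<and> uniserial_ring A \<and>
          artinian_ring A \<and> centrally_essential A \<and>
          A Quot (jacobson_radical A) \<simeq> F \<and> has_nilpotence_index A (jacobson_radical A) n"
    if "field F" "derivation F D1" "derivation F D2" "incomparable_kernels F D1 D2" "n \<ge> 2"
    for F :: "('a, 'm) ring_scheme" and D1 D2 and n :: nat
  proof -
    \<comment> \<open>Incomparability is not part of the locale; it enters through
      \<open>properties_A\<close>, for non-commutativity.\<close>
    interpret twisted_truncation F D1 D2 n
      using that by (simp add: twisted_truncation_def twisted_truncation_axioms_def)
    show ?thesis using properties_A that(4) by blast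
  qed
  moreover have "derivation (ring_of_type_algebra :: rat_xy ring) partial_x"
    unfolding partial_x_def by (rule derivation_fract_deriv) (simp_all add: pderiv_add pderiv_Leibniz)
  moreover have "derivation (ring_of_type_algebra :: rat_xy ring) partial_y"
    unfolding partial_y_def
    by (rule derivation_fract_deriv) (simp_all add: map_poly_pderiv_add map_poly_pderiv_mult)
  ultimately show ?thesis
    using field_from_type_algebra incomparable_kernels_partials by (auto simp: Let_def)
qed

end
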